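(* Let $p\geq 5$ be a prime and let $n$ be a positive integer. Then $$\frac{1}{n}\left(\sum_{k=0}^{pn-1}(2k+1)A_k-p\sum_{k=0}^{n-1}(2k+1)A_k\right)\equiv 0\pmod{p^{4+3\nu_p(n)}}$$ and $$\frac{1}{n^3}\left(\sum_{k=0}^{pn-1}(2k+1)^3A_k-p^3\sum_{k=0}^{n-1}(2k+1)^3A_k\right)\equiv 0\pmod{p^{6+3\nu_p(n)}}.$$
   Context: For each integer $n\ge 0$, the Ap\'ery number $A_n$ is $$A_n=\sum_{k=0}^{n}\binom{n}{k}^2\binom{n+k}{k}^2=\sum_{k=0}^{n}\binom{n+k}{2k}^2\binom{2k}{k}^2.$$ For a positive integer $n$, $\nu_p(n)$ denotes the $p$-adic order of $n$, i.e. the largest integer $a\ge 0$ with $p^a\mid n$. For a rational number $x$ and an integer $N\ge 0$, the congruence $x\equiv 0\pmod{p^N}$ means that $x\in p^N\mathbb{Z}_{(p)}$, where $\mathbb{Z}_{(p)}$ is the ring of rational numbers whose denominator in lowest terms is not divisible by $p$. *)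

theory Defs
  imports Complex_Main "HOL-Computational_Algebra.Primes"
begin

definition apery :: "nat \<Rightarrow> nat" where
  "apery n = (\<Sum>k=0..n. (n choose k)^2 * ((n + k) choose k)^2)"

lemma apery_altdef:
  "apery n = (\<Sum>k=0..n. ((n + k) choose (2 * k))^2 * ((2 * k) choose k)^2)"
  unfolding apery_def
proof (rule sum.cong)
  fix k assume "k \<in> {0..n}"
  then have "k \<le> 2 * k" "2 * k \<le> n + k" by auto
  from choose_mult[OF this]
  have "((n + k) choose (2 * k)) * ((2 * k) choose k) = ((n + k) choose k) * (n choose k)"
    by (simp add: mult_2)
  then show "(n choose k)^2 * ((n + k) choose k)^2
      = ((n + k) choose (2 * k))^2 * ((2 * k) choose k)^2"
    by (metis mult.commute power_mult_distrib)
qed simp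

text \<open>The localization $\mathbf{Z}_{(p)}$ as a subset of the rationals;
  \<^const>\<open>quotient_of\<close> yields the fraction in lowest terms.\<close>

definition Z_loc :: "nat \<Rightarrow> rat set" where
  "Z_loc p = {x. \<not> int p dvd snd (quotient_of x)}"

definition rat_cong_0 :: "rat \<Rightarrow> nat \<Rightarrow> nat \<Rightarrow> bool" where
  "rat_cong_0 x p N \<longleftrightarrow> x \<in> (\<lambda>y. of_nat p ^ N * y) ` Z_loc p"

end

theory Submission
  imports Defs "HOL-Computational_Algebra.Polynomial"
begin

text \<open>
Write c(n,j) for the product of (1 - n^2/i^2)^2 over 1 \<le> i \<le> j; up to sign its square root is
the product of the binomial coefficients (n+j choose j) and (n-1 choose j), so c(n,j) is an
integer. Summing the defining double sum over k first, where both inner sums telescope, gives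

  \<Sum>k<n. (2k+1) A(k) = n^2 * (\<Sum>j<n. c(n,j)/(2j+1)),
  \<Sum>k<n. (2k+1)^3 A(k) = n^6 * (\<Sum>j<n. c(n,j)/(j+1)^3),

the second one after a further summation by parts (\<open>sum_odd_apery\<close>, \<open>sum_odd_cube_apery\<close>).
The weights at level pn and level n are linked by c(pn,j) = c(n, j div p) * W(j)^2, where W(j) is
the product of 1 - (pn)^2/i^2 over the i \<le> j prime to p (\<open>apery_weight_mult_p\<close>). In both
congruences the terms at level pn whose denominator is divisible by p correspond to the terms at
level n, and the difference of corresponding terms is controlled by W(j)^2 - 1.

The needed strength comes from a doubling symmetry. On the units modulo q = p^a the map
u \<mapsto> 2u is a permutation, so a symmetric polynomial e of degree k in the numbers 1/u^2 satisfies
(4^k - 1) e \<equiv> 0 modulo q. As p \<ge> 5, the number 3 is a unit, whence \<Sum>1/u^2 \<equiv> 0 modulo q;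
and 4^k - 1 contains p at most 2(k-1) times, so for x divisible by p^2 the product of the
1 - x/u^2 is 1 modulo q x. This yields W(pM-1) \<equiv> 1 modulo p M (pn)^2 (\<open>unit_prod_full\<close>) and, by
reflecting i to p(2m+1) - i, the corresponding result for W(j)^2 at 2j+1 = p(2m+1)
(\<open>unit_prod_half\<close>).

For the cubes this is already enough: terms with j+1 prime to p are integral and get the factor
p^3, and for j+1 = p(m+1) the factor W(j)^2 - 1 supplies p^3 n^2 (m+1), while
n^2 c(n,m)/(m+1)^2 is an integer. For the first sum the terms with 2j+1 prime to p need an
argument of their own: their sum must vanish modulo p^(2a) when p^a divides pn. Reflection in a
block of length p^b and \<Sum>1/u^2 \<equiv> 0 show that the reciprocals of the 2j+1 prime to p in such a
block add up to 0 modulo p^(2b), and since c(pn,j) \<equiv> c(n, j div p) modulo (pn)^2, inserting the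
weights does not destroy this, as one sees by merging blocks of length p one level at a time
(\<open>odd_reciprocal_block_sum\<close>, \<open>weighted_sum_of_small_blocks\<close>).
\<close>

section \<open>Closed forms for the sums of odd powers times Apery numbers\<close>

definition apery_weight :: "nat \<Rightarrow> nat \<Rightarrow> rat" where
  "apery_weight n j = (\<Prod>i=1..j. 1 - of_nat n ^ 2 / of_nat i ^ 2) ^ 2"

lemma Suc_times_binomial_Suc_rat:
  "of_nat (Suc j) * of_nat (N choose Suc j) = (of_nat N - of_nat j) * (of_nat (N choose j) :: rat)"
proof (cases "j \<le> N")
  case True
  have "Suc j * (N choose Suc j) = (N - j) * (N choose j)"
    by (metis binomial_absorb_comp binomial_absorption)
  then have "(of_nat (Suc j * (N choose Suc j)) :: rat) = of_nat ((N - j) * (N choose j))"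
    by (simp only:)
  then show ?thesis using True by (simp only: of_nat_mult of_nat_diff)
qed (simp add: binomial_eq_0)

text \<open>Integrality of the weights, which the product formula hides: each factor 1 - n^2/i^2 splits as
-((n+i)/i)((n-i)/i), and the two halves build up binomial coefficients.\<close>

lemma apery_weight_binomial:
  assumes "n > 0"
  shows "apery_weight n j = (of_nat ((n + j) choose j) * of_nat ((n - 1) choose j)) ^ 2"
proof -
  have "(\<Prod>i=1..j. 1 - of_nat n ^ 2 / of_nat i ^ 2 :: rat)
      = (- 1) ^ j * (of_nat ((n + j) choose j) * of_nat ((n - 1) choose j))"
  proof (induction j)
    case (Suc j)
    have 1: "(of_nat (Suc j) :: rat) * of_nat ((n + Suc j) choose Suc j)
        = (of_nat n + of_nat (Suc j)) * of_nat ((n + j) choose j)"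
      using Suc_times_binomial_eq[of "n + j" j]
      by (metis add_Suc_right mult.commute of_nat_add of_nat_mult)
    have 2: "(of_nat (Suc j) :: rat) * of_nat ((n - 1) choose Suc j)
        = (of_nat n - of_nat (Suc j)) * of_nat ((n - 1) choose j)"
      using Suc_times_binomial_Suc_rat[of j "n - 1"] assms by (simp add: of_nat_diff)
    have "(of_nat (Suc j) :: rat) \<noteq> 0" by (simp only: of_nat_eq_0_iff)
    have gen: "y * (1 - N ^ 2 / s ^ 2) = - (c' * d')"
      if "s \<noteq> 0" "s * c' = (N + s) * c" "s * d' = (N - s) * d" "y = c * d"
      for N s c c' d d' y :: rat
    proof -
      have "y * (1 - N ^ 2 * t ^ 2) = - (c' * d')" if "s * t = 1" for t
        using that \<open>s * c' = _\<close> \<open>s * d' = _\<close> \<open>y = _\<close> by algebra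
      from this[OF right_inverse[OF that(1)]] show ?thesis
        by (simp only: divide_inverse power_inverse)
    qed
    have "of_nat ((n + j) choose j) * of_nat ((n - 1) choose j) * (1 - of_nat n ^ 2 / of_nat (Suc j) ^ 2)
        = - (of_nat ((n + Suc j) choose Suc j) * of_nat ((n - 1) choose Suc j) :: rat)"
      by (rule gen[OF _ 1 2 refl]) fact
    moreover have "(\<Prod>i=1..Suc j. 1 - of_nat n ^ 2 / of_nat i ^ 2 :: rat)
        = (- 1) ^ j * (of_nat ((n + j) choose j) * of_nat ((n - 1) choose j)
            * (1 - of_nat n ^ 2 / of_nat (Suc j) ^ 2))"
      using Suc by (simp add: mult.assoc)
    ultimately show ?case by simp
  qed simp
  then show ?thesis by (simp add: apery_weight_def power_mult_distrib flip: power_mult)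
qed

lemma apery_weight_of_nat:
  assumes "n > 0" obtains m where "apery_weight n j = of_nat m"
  using apery_weight_binomial[OF assms, of j] by (metis of_nat_mult of_nat_power)

lemma apery_weight_self: "n > 0 \<Longrightarrow> apery_weight n n = 0"
  by (simp add: apery_weight_binomial)

lemma apery_weight_Suc:
  "apery_weight n (Suc j) = apery_weight n j * (1 - of_nat n ^ 2 / of_nat (Suc j) ^ 2) ^ 2"
  by (simp add: apery_weight_def power_mult_distrib)

text \<open>The shape in which the weights arise: the telescoped inner sums below carry the factor
(n-j)^2 (n+j choose 2j)^2.\<close>

lemma weight_eq_binomials:
  assumes "j < n"
  shows "((of_nat n - of_nat j) * of_nat ((n + j) choose (2 * j)) * of_nat ((2 * j) choose j)) ^ 2
      = of_nat n ^ 2 * apery_weight n j"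
proof -
  have "((n + j) choose (2 * j)) * ((2 * j) choose j) = ((n + j) choose j) * (n choose j)"
    using choose_mult[of j "2 * j" "n + j"] assms by (simp add: mult_2)
  then have "(n - j) * (((n + j) choose (2 * j)) * ((2 * j) choose j))
      = ((n + j) choose j) * ((n - j) * (n choose j))"
    by simp
  also have "(n - j) * (n choose j) = n * ((n - 1) choose j)"
    by (rule binomial_absorb_comp)
  finally have "(of_nat ((n - j) * (((n + j) choose (2 * j)) * ((2 * j) choose j))) :: rat)
      = of_nat (((n + j) choose j) * (n * ((n - 1) choose j)))"
    by (simp only:)
  then show ?thesis
    using assms by (simp add: apery_weight_binomial of_nat_diff mult_ac flip: power_mult_distrib)
qed

text \<open>Interchanging the two summations reduces a weighted sum of Apery numbers to an inner sum over k
for each j; the premise is that this inner sum telescopes with a rational certificate g.\<close>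

lemma sum_apery_from_binomial_sum:
  fixes f :: "nat \<Rightarrow> rat" and g :: "nat \<Rightarrow> rat"
  assumes "\<And>j. j < n \<Longrightarrow> (\<Sum>k<n. f k * of_nat ((k + j) choose (2 * j)) ^ 2)
      = g j * ((of_nat n - of_nat j) * of_nat ((n + j) choose (2 * j))) ^ 2"
  shows "(\<Sum>k<n. f k * of_nat (apery k)) = of_nat n ^ 2 * (\<Sum>j<n. g j * apery_weight n j)"
proof -
  have "(\<Sum>k<n. f k * of_nat (apery k))
      = (\<Sum>k<n. \<Sum>j<n. f k * of_nat ((k + j) choose (2 * j)) ^ 2 * of_nat ((2 * j) choose j) ^ 2)"
  proof (rule sum.cong)
    fix k assume "k \<in> {..<n}"
    \<comment> \<open>the terms with j > k vanish, so that the range of j can be made independent of k\<close>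
    then have "apery k = (\<Sum>j<n. ((k + j) choose (2 * j))^2 * ((2 * j) choose j)^2)"
      unfolding apery_altdef by (intro sum.mono_neutral_left) auto
    then show "f k * of_nat (apery k)
        = (\<Sum>j<n. f k * of_nat ((k + j) choose (2 * j)) ^ 2 * of_nat ((2 * j) choose j) ^ 2)"
      by (simp add: sum_distrib_left mult.assoc)
  qed simp
  also have "\<dots> = (\<Sum>j<n. \<Sum>k<n. f k * of_nat ((k + j) choose (2 * j)) ^ 2 * of_nat ((2 * j) choose j) ^ 2)"
    by (rule sum.swap)
  also have "\<dots> = (\<Sum>j<n. of_nat n ^ 2 * (g j * apery_weight n j))"
  proof (rule sum.cong)
    fix j assume j: "j \<in> {..<n}"
    have "(\<Sum>k<n. f k * of_nat ((k + j) choose (2 * j)) ^ 2 * of_nat ((2 * j) choose j) ^ 2)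
        = g j * ((of_nat n - of_nat j) * of_nat ((n + j) choose (2 * j))) ^ 2 * of_nat ((2 * j) choose j) ^ 2"
      using assms[of j] j by (simp flip: sum_distrib_right)
    also have "\<dots> = g j * (of_nat n ^ 2 * apery_weight n j)"
      using weight_eq_binomials[of j n] j by (simp add: power_mult_distrib mult.assoc)
    finally show "(\<Sum>k<n. f k * of_nat ((k + j) choose (2 * j)) ^ 2 * of_nat ((2 * j) choose j) ^ 2)
        = of_nat n ^ 2 * (g j * apery_weight n j)" by (simp add: mult_ac)
  qed simp
  finally show ?thesis by (simp add: sum_distrib_left)
qed

text \<open>This ratio of consecutive binomial coefficients drives both telescoping sums.\<close>

lemma binomial_shift_rat:
  "(of_nat (Suc n) - of_nat j) * of_nat ((Suc n + j) choose (2 * j))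
    = (of_nat n + of_nat j + 1) * (of_nat ((n + j) choose (2 * j)) :: rat)"
proof (cases "2 * j \<le> Suc n + j")
  case True
  have "(Suc n + j - 2 * j) * ((Suc n + j) choose (2 * j)) = (Suc n + j) * ((n + j) choose (2 * j))"
    using binomial_absorb_comp[of "Suc n + j" "2 * j"] by simp
  then have "(of_nat ((Suc n + j - 2 * j) * ((Suc n + j) choose (2 * j))) :: rat)
      = of_nat ((Suc n + j) * ((n + j) choose (2 * j)))"
    by (simp only:)
  then show ?thesis using True by (simp only: of_nat_mult of_nat_diff) (simp add: algebra_simps)
qed (simp add: binomial_eq_0)

text \<open>The summand is the forward difference in n of the right-hand side, because
(n+j+1)^2 - (n-j)^2 = (2n+1)(2j+1).\<close>

lemma sum_odd_binomial_square:
  "(\<Sum>k<n. (2 * of_nat k + 1) * of_nat ((k + j) choose (2 * j)) ^ 2 :: rat)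
    = 1 / (2 * of_nat j + 1) * ((of_nat n - of_nat j) * of_nat ((n + j) choose (2 * j))) ^ 2"
    (is "?L n = ?R n")
proof (induction n)
  case (Suc n)
  define J where "J = (2 * of_nat j + 1 :: rat)"
  have "J = of_nat (2 * j + 1)" by (simp add: J_def)
  then have J: "J \<noteq> 0" by (simp only: of_nat_eq_0_iff)
  define b where "b = (of_nat ((n + j) choose (2 * j)) :: rat)"
  have "J * ?R (Suc n) = ((of_nat n + of_nat j + 1) * b) ^ 2"
    unfolding binomial_shift_rat J_def[symmetric] b_def using J by simp
  also have "\<dots> = ((of_nat n - of_nat j) * b) ^ 2 + J * ((2 * of_nat n + 1) * b ^ 2)"
    by (simp add: J_def power2_eq_square algebra_simps)
  also have "((of_nat n - of_nat j) * b) ^ 2 = J * ?R n"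
    unfolding J_def[symmetric] b_def[symmetric] using J by simp
  finally have "J * ?R (Suc n) = J * (?R n + (2 * of_nat n + 1) * b ^ 2)"
    by (simp only: distrib_left)
  then have "?R (Suc n) = ?R n + (2 * of_nat n + 1) * b ^ 2"
    using J by (simp only: mult_cancel_left) simp
  then show ?case using Suc by (simp add: b_def)
qed (cases "j = 0"; simp add: binomial_eq_0)

text \<open>With the ansatz (n-j)^2 (\<alpha> n^2 + \<beta>) (n+j choose 2j)^2 for the antidifference, comparing
coefficients gives \<alpha> = 2/(j+1) and \<beta> = -1.\<close>

lemma sum_odd_cube_binomial_square:
  "(\<Sum>k<n. (2 * of_nat k + 1) ^ 3 * of_nat ((k + j) choose (2 * j)) ^ 2 :: rat)
    = (2 * of_nat n ^ 2 / (of_nat j + 1) - 1)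
      * ((of_nat n - of_nat j) * of_nat ((n + j) choose (2 * j))) ^ 2"
    (is "?L n = ?R n")
proof (induction n)
  case (Suc n)
  define J where "J = (of_nat j + 1 :: rat)"
  have J: "J \<noteq> 0"
    by (metis J_def of_nat_0_eq_iff of_nat_Suc add.commute nat.distinct(1))
  define b where "b = (of_nat ((n + j) choose (2 * j)) :: rat)"
  define N where "N = (of_nat n :: rat)"
  have j: "of_nat j = J - 1" by (simp add: J_def)
  have "?R (Suc n) = (2 * (N + 1) ^ 2 / J - 1) * ((N + J) * b) ^ 2"
    unfolding binomial_shift_rat J_def[symmetric] b_def[symmetric] N_def[symmetric]
    by (simp add: N_def J_def add_ac)
  also have "\<dots> = (2 * N ^ 2 / J - 1) * ((N - (J - 1)) * b) ^ 2 + (2 * N + 1) ^ 3 * b ^ 2"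
  proof -
    \<comment> \<open>the reciprocal of J as a ring variable turns the claim into a polynomial identity modulo J y = 1\<close>
    have "(2 * (N + 1) ^ 2 * y - 1) * ((N + J) * b) ^ 2
        = (2 * N ^ 2 * y - 1) * ((N - (J - 1)) * b) ^ 2 + (2 * N + 1) ^ 3 * b ^ 2"
      if "J * y = 1" for y
      using that by algebra
    from this[OF right_inverse[OF J]] show ?thesis by (simp only: divide_inverse)
  qed
  also have "(2 * N ^ 2 / J - 1) * ((N - (J - 1)) * b) ^ 2 = ?R n"
    by (simp add: J_def N_def b_def)
  finally show ?case using Suc by (simp add: b_def N_def)
qed (cases "j = 0"; simp add: binomial_eq_0)

lemma sum_odd_apery:
  "(\<Sum>k<n. (2 * of_nat k + 1) * of_nat (apery k))
    = of_nat n ^ 2 * (\<Sum>j<n. apery_weight n j / of_nat (2 * j + 1))"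
  using sum_apery_from_binomial_sum[of n "\<lambda>k. 2 * of_nat k + 1" "\<lambda>j. 1 / (2 * of_nat j + 1)",
      OF sum_odd_binomial_square]
  by (simp add: add.commute)

text \<open>The inner sums give n^2 times the sum of (2n^2/(j+1) - 1) c(n,j), in which the high power of n is
not visible. Summation by parts reveals it: by the recursion for the weights, the differences of
j c(n,j) are the terms of this sum up to sign, plus n^4 c(n,j)/(j+1)^3, and j c(n,j) vanishes at
both ends j = 0 and j = n.\<close>

lemma sum_odd_cube_apery:
  assumes "n > 0"
  shows "(\<Sum>k<n. (2 * of_nat k + 1) ^ 3 * of_nat (apery k))
    = of_nat n ^ 6 * (\<Sum>j<n. apery_weight n j / of_nat (Suc j) ^ 3)"
proof -
  let ?c = "apery_weight n" and ?N = "of_nat n :: rat"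
  have step: "(of_nat (Suc j) * ?c (Suc j) - of_nat j * ?c j)
      = ?N ^ 4 * (?c j / of_nat (Suc j) ^ 3) - (2 * ?N ^ 2 / (of_nat j + 1) - 1) * ?c j" for j
  proof -
    define J where "J = (of_nat j + 1 :: rat)"
    have J: "J \<noteq> 0"
      by (metis J_def of_nat_0_eq_iff of_nat_Suc add.commute nat.distinct(1))
    have j: "of_nat j = J - 1" "of_nat (Suc j) = J" by (simp_all add: J_def)
    have J1: "of_nat j + 1 = J" by (simp add: J_def)
    have "J * (c * (1 - N ^ 2 * y ^ 2) ^ 2) - (J - 1) * c
        = N ^ 4 * (c * y ^ 3) - (2 * N ^ 2 * y - 1) * c"
      if "J * y = 1" for y c N
      using that by algebra
    from this[OF right_inverse[OF J]] show ?thesis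
      unfolding apery_weight_Suc J1 j(2) unfolding j(1)
      by (simp only: divide_inverse power_inverse)
  qed
  have "(\<Sum>j<n. of_nat (Suc j) * ?c (Suc j) - of_nat j * ?c j) = of_nat n * ?c n - of_nat 0 * ?c 0"
    by (rule sum_lessThan_telescope)
  then have "(\<Sum>j<n. (2 * ?N ^ 2 / (of_nat j + 1) - 1) * ?c j)
      = ?N ^ 4 * (\<Sum>j<n. ?c j / of_nat (Suc j) ^ 3)"
    using assms by (simp only: step) (simp add: sum_subtractf sum_distrib_left apery_weight_self)
  moreover have "(\<Sum>k<n. (2 * of_nat k + 1) ^ 3 * of_nat (apery k))
      = ?N ^ 2 * (\<Sum>j<n. (2 * ?N ^ 2 / (of_nat j + 1) - 1) * ?c j)"
    by (rule sum_apery_from_binomial_sum) (rule sum_odd_cube_binomial_square)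
  ultimately show ?thesis by (simp add: mult.assoc[symmetric] flip: power_add)
qed

section \<open>Divisibility in the localization at p\<close>

text \<open>A description by arbitrary fractions, from which the ring operations are immediate; lowest terms
are awkward to maintain under addition and multiplication.\<close>

lemma Z_loc_iff: "x \<in> Z_loc p \<longleftrightarrow> (\<exists>a b. \<not> int p dvd b \<and> x = of_int a / of_int b)"
proof
  assume "x \<in> Z_loc p"
  moreover obtain c d where "quotient_of x = (c, d)" by fastforce
  ultimately show "\<exists>a b. \<not> int p dvd b \<and> x = of_int a / of_int b"
    using quotient_of_div[of x c d] by (auto simp: Z_loc_def)
next
  assume "\<exists>a b. \<not> int p dvd b \<and> x = of_int a / of_int b"
  then obtain a b where b: "\<not> int p dvd b" and x: "x = of_int a / of_int b" by blast
  obtain c d where q: "quotient_of x = (c, d)" by fastforce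
  have d: "x = of_int c / of_int d" "coprime c d" "d > 0"
    using q quotient_of_div quotient_of_coprime quotient_of_denom_pos by blast+
  have "b \<noteq> 0" using b by auto
  then have "(of_int (c * b) :: rat) = of_int (a * d)"
    using x d by (simp add: field_simps)
  then have "c * b = a * d" by (simp only: of_int_eq_iff)
  then have "d dvd c * b" by simp
  then have "d dvd b" using d(2) by (simp add: coprime_commute coprime_dvd_mult_right_iff)
  then show "x \<in> Z_loc p" using b q by (auto simp: Z_loc_def)
qed

locale prime_ge_5 =
  fixes p :: nat
  assumes prime: "prime p" and ge_5: "p \<ge> 5"
begin

lemma p_gt_0 [simp]: "p > 0" and p_nonzero [simp]: "p \<noteq> 0" using ge_5 by auto

lemma odd_p: "odd p" using prime ge_5 prime_odd_nat by auto

lemma prime_int: "prime (int p)" using prime by simp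

lemma not_dvd_nonzero: "\<not> int p dvd k \<Longrightarrow> (of_int k :: rat) \<noteq> 0"
  by auto

lemma not_dvd_small: "0 < k \<Longrightarrow> k < 5 \<Longrightarrow> \<not> int p dvd k"
  using ge_5 zdvd_not_zless[of k "int p"] by auto

lemma Z_of_int [simp]: "of_int a \<in> Z_loc p"
  unfolding Z_loc_iff using not_dvd_small[of 1] by (intro exI[of _ a] exI[of _ 1]) auto

lemma Z_of_nat [simp]: "of_nat a \<in> Z_loc p"
  using Z_of_int[of "int a"] by simp

lemma Z_0 [simp]: "0 \<in> Z_loc p" and Z_1 [simp]: "1 \<in> Z_loc p"
  and Z_numeral [simp]: "numeral w \<in> Z_loc p"
  using Z_of_int[of 0] Z_of_int[of 1] Z_of_int[of "numeral w"] by simp_all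

lemma Z_mult [intro]: "x \<in> Z_loc p \<Longrightarrow> y \<in> Z_loc p \<Longrightarrow> x * y \<in> Z_loc p"
  unfolding Z_loc_iff
proof (elim exE conjE)
  fix a b a' b'
  assume "\<not> int p dvd b" "\<not> int p dvd b'" "x = of_int a / of_int b" "y = of_int a' / of_int b'"
  then show "\<exists>a b. \<not> int p dvd b \<and> x * y = of_int a / of_int b"
    using prime_int by (intro exI[of _ "a * a'"] exI[of _ "b * b'"]) (auto simp: prime_dvd_mult_iff)
qed

lemma Z_add [intro]: "x \<in> Z_loc p \<Longrightarrow> y \<in> Z_loc p \<Longrightarrow> x + y \<in> Z_loc p"
  unfolding Z_loc_iff
proof (elim exE conjE)
  fix a b a' b'
  assume "\<not> int p dvd b" "\<not> int p dvd b'" "x = of_int a / of_int b" "y = of_int a' / of_int b'"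
  then show "\<exists>a b. \<not> int p dvd b \<and> x + y = of_int a / of_int b"
    using prime_int not_dvd_nonzero[of b] not_dvd_nonzero[of b']
    by (intro exI[of _ "a * b' + a' * b"] exI[of _ "b * b'"])
       (auto simp: prime_dvd_mult_iff add_divide_eq_iff divide_add_eq_iff field_simps)
qed

lemma Z_minus [intro]: "x \<in> Z_loc p \<Longrightarrow> - x \<in> Z_loc p"
  using Z_mult[of "of_int (-1)" x] by (simp del: of_int_minus) simp

lemma Z_diff [intro]: "x \<in> Z_loc p \<Longrightarrow> y \<in> Z_loc p \<Longrightarrow> x - y \<in> Z_loc p"
  using Z_add[of x "- y"] Z_minus[of y] by simp

lemma Z_power [intro]: "x \<in> Z_loc p \<Longrightarrow> x ^ k \<in> Z_loc p"
  by (induction k) auto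

lemma Z_prod [intro]: "(\<And>i. i \<in> S \<Longrightarrow> f i \<in> Z_loc p) \<Longrightarrow> prod f S \<in> Z_loc p"
  by (induction S rule: infinite_finite_induct) auto

lemma Z_inverse: "\<not> int p dvd k \<Longrightarrow> 1 / of_int k \<in> Z_loc p"
  unfolding Z_loc_iff by (intro exI[of _ 1] exI[of _ k]) auto

lemma Z_inverse_nat: "\<not> p dvd k \<Longrightarrow> 1 / of_nat k \<in> Z_loc p"
  using Z_inverse[of "int k"] by simp

text \<open>Divisibility in the localization, for a rational modulus. Moduli such as p M x with
rational x occur below, so the modulus is an arbitrary element and not just a power of p.\<close>

definition ldvd :: "rat \<Rightarrow> rat \<Rightarrow> bool" where
  "ldvd m x \<longleftrightarrow> (\<exists>z \<in> Z_loc p. x = m * z)"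

lemma rat_cong_0_iff: "rat_cong_0 x p N \<longleftrightarrow> ldvd (of_nat p ^ N) x"
  by (auto simp: rat_cong_0_def ldvd_def)

lemma ldvd_1 [simp]: "ldvd 1 x \<longleftrightarrow> x \<in> Z_loc p"
  by (simp add: ldvd_def)

lemma ldvd_0 [simp]: "ldvd m 0"
  by (auto simp: ldvd_def intro: bexI[of _ 0])

lemma ldvd_add: "ldvd m x \<Longrightarrow> ldvd m y \<Longrightarrow> ldvd m (x + y)"
  unfolding ldvd_def by (metis Z_add distrib_left)

lemma ldvd_diff: "ldvd m x \<Longrightarrow> ldvd m y \<Longrightarrow> ldvd m (x - y)"
  unfolding ldvd_def by (metis Z_diff right_diff_distrib)

lemma ldvd_sum: "(\<And>i. i \<in> S \<Longrightarrow> ldvd m (f i)) \<Longrightarrow> ldvd m (sum f S)"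
  by (induction S rule: infinite_finite_induct) (auto intro: ldvd_add)

lemma ldvd_mult: "ldvd m x \<Longrightarrow> ldvd k y \<Longrightarrow> ldvd (m * k) (x * y)"
  unfolding ldvd_def by (metis Z_mult mult.assoc mult.left_commute)

lemma ldvd_mult_left: "ldvd m x \<Longrightarrow> y \<in> Z_loc p \<Longrightarrow> ldvd m (y * x)"
  using ldvd_mult[of m x 1 y] by (simp add: mult.commute)

lemma ldvd_mult_right: "ldvd m x \<Longrightarrow> y \<in> Z_loc p \<Longrightarrow> ldvd m (x * y)"
  using ldvd_mult[of m x 1 y] by simp

lemma ldvd_self: "z \<in> Z_loc p \<Longrightarrow> ldvd m (m * z)"
  by (auto simp: ldvd_def)

lemma ldvd_trans: "ldvd m k \<Longrightarrow> ldvd k x \<Longrightarrow> ldvd m x"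
  unfolding ldvd_def by (metis Z_mult mult.assoc)

lemma ldvd_integral: "m \<in> Z_loc p \<Longrightarrow> ldvd m x \<Longrightarrow> x \<in> Z_loc p"
  by (auto simp: ldvd_def)

lemma ldvd_unit_cancel:
  assumes "ldvd m (of_int k * x)" "\<not> int p dvd k"
  shows "ldvd m x"
proof -
  have "ldvd m (1 / of_int k * (of_int k * x))"
    using assms by (intro ldvd_mult_left[OF _ Z_inverse])
  then show ?thesis using not_dvd_nonzero[OF assms(2)] by simp
qed

lemma ldvd_unit_mult:
  assumes "ldvd m x" "\<not> int p dvd k"
  shows "ldvd (m * of_int k) x"
proof -
  have "ldvd (m * of_int k) (x * of_int k * (1 / of_int k))"
    using assms by (intro ldvd_mult_right ldvd_mult Z_inverse) (auto simp: ldvd_def intro: bexI[of _ 1])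
  then show ?thesis using not_dvd_nonzero[OF assms(2)] by simp
qed

lemma ldvd_of_int: "m dvd k \<Longrightarrow> ldvd (of_int m) (of_int k)"
  by (auto elim!: dvdE intro!: ldvd_self)

lemma ldvd_prod_diff:
  assumes "\<And>i. i \<in> S \<Longrightarrow> f i \<in> Z_loc p" "\<And>i. i \<in> S \<Longrightarrow> g i \<in> Z_loc p"
    and "\<And>i. i \<in> S \<Longrightarrow> ldvd m (f i - g i)"
  shows "ldvd m (prod f S - prod g S)"
  using assms
proof (induction S rule: infinite_finite_induct)
  case (insert i S)
  have "ldvd m (f i * (prod f S - prod g S) + (f i - g i) * prod g S)"
    using insert by (intro ldvd_add ldvd_mult_left ldvd_mult_right Z_prod) auto
  moreover have "f i * (prod f S - prod g S) + (f i - g i) * prod g S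
      = f i * prod f S - g i * prod g S"
    by (simp add: algebra_simps)
  ultimately show ?case using insert by simp
qed auto

lemma ldvd_inverse_diff:
  assumes "\<not> int p dvd u" "\<not> int p dvd v" "ldvd m (of_int (u - v))"
  shows "ldvd m (1 / of_int u - 1 / of_int v)"
proof -
  have "ldvd m (of_int (u - v) * (- (1 / of_int u * (1 / of_int v))))"
    using assms by (intro ldvd_mult_right Z_minus Z_mult Z_inverse)
  moreover have "of_int (u - v) * (- (1 / of_int u * (1 / of_int v)))
      = (1 / of_int u - 1 / of_int v :: rat)"
    using not_dvd_nonzero[OF assms(1)] not_dvd_nonzero[OF assms(2)] by (simp add: field_simps)
  ultimately show ?thesis by simp
qed

lemma ldvd_inverse_square_diff:
  assumes "\<not> int p dvd u" "\<not> int p dvd v" "ldvd m (of_int (u - v))"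
  shows "ldvd m (1 / of_int u ^ 2 - 1 / of_int v ^ 2)"
proof -
  have "ldvd m ((1 / of_int u - 1 / of_int v) * (1 / of_int u + 1 / of_int v))"
    using assms by (intro ldvd_mult_right ldvd_inverse_diff Z_add Z_inverse)
  then show ?thesis by (simp add: power2_eq_square algebra_simps)
qed

section \<open>Index sets stable under doubling\<close>

text \<open>Congruent integral factors have congruent products, coefficient by coefficient.\<close>

lemma ldvd_coeff_prod:
  fixes f g :: "'a \<Rightarrow> rat poly"
  assumes "\<And>i k. i \<in> S \<Longrightarrow> coeff (f i) k \<in> Z_loc p"
    and "\<And>i k. i \<in> S \<Longrightarrow> coeff (g i) k \<in> Z_loc p"
    and "\<And>i k. i \<in> S \<Longrightarrow> ldvd m (coeff (f i - g i) k)"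
  shows "coeff (prod f S) k \<in> Z_loc p \<and> ldvd m (coeff (prod f S - prod g S) k)"
proof -
  have Z: "coeff (a * b) k \<in> Z_loc p"
    if "\<And>k. coeff a k \<in> Z_loc p" "\<And>k. coeff b k \<in> Z_loc p" for a b :: "rat poly" and k
    unfolding coeff_mult ldvd_1[symmetric] using that by (intro ldvd_sum) auto
  have M: "ldvd m (coeff (a * b) k)"
    if "\<And>k. ldvd m (coeff a k)" "\<And>k. coeff b k \<in> Z_loc p" for a b :: "rat poly" and k
    unfolding coeff_mult using that by (intro ldvd_sum ldvd_mult_right) auto
  have "\<forall>k. coeff (prod f S) k \<in> Z_loc p \<and> coeff (prod g S) k \<in> Z_loc p
      \<and> ldvd m (coeff (prod f S - prod g S) k)"
    using assms
  proof (induction S rule: infinite_finite_induct)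
    case (insert i S)
    \<comment> \<open>replace one factor at a time\<close>
    have "f i * prod f S - g i * prod g S
        = (prod f S - prod g S) * f i + (f i - g i) * prod g S"
      by (simp add: algebra_simps)
    moreover have "ldvd m (coeff ((prod f S - prod g S) * f i + (f i - g i) * prod g S) k)" for k
      unfolding coeff_add using insert by (intro ldvd_add M) auto
    ultimately have "ldvd m (coeff (f i * prod f S - g i * prod g S) k)" for k by simp
    then show ?case using insert by (auto intro: Z)
  qed (auto simp: coeff_1)
  then show ?thesis by blast
qed

text \<open>The bound 4^k - 1 < 5^(2k-1) \<le> p^(2k-1) shows that p divides 4^k - 1 at most 2(k-1) times. This
crude estimate suffices since it is matched exactly by the power x^(k-1) of an x divisible
by p^2.\<close>

lemma four_power_minus_one_unit:
  assumes "k \<ge> 1"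
  obtains t u where "(4::int) ^ k - 1 = int p ^ t * u" "\<not> int p dvd u" "t \<le> 2 * (k - 1)"
proof -
  have k: "(4::int) ^ k - 1 > 0" using assms by (simp add: one_less_power)
  have np: "\<not> is_unit (int p)" using ge_5 by auto
  obtain u where u: "(4::int) ^ k - 1 = int p ^ multiplicity (int p) (4 ^ k - 1) * u"
    "\<not> int p dvd u"
    using multiplicity_decompose'[of "4 ^ k - 1" "int p"] k np by (metis less_irrefl)
  define t where "t = multiplicity (int p) (4 ^ k - 1)"
  have *: "(4::int) ^ k < 5 ^ (2 * k - 1)"
    using assms
  proof (induction k rule: dec_induct)
    case (step k)
    have "(4::int) ^ Suc k \<le> 25 * 4 ^ k" by simp
    also have "\<dots> < 25 * 5 ^ (2 * k - 1)" using step by simp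
    also have "\<dots> = 5 ^ Suc (Suc (2 * k - 1))" by simp
    also have "Suc (Suc (2 * k - 1)) = 2 * Suc k - 1" using step by simp
    finally show ?case .
  qed simp
  have "u > 0" using u(1) k by (metis of_nat_0_le_iff zero_le_power zero_less_mult_pos mult_nonneg_nonpos not_le)
  have "\<not> 2 * k - 1 \<le> t"
  proof
    assume "2 * k - 1 \<le> t"
    then have "(5::int) ^ (2 * k - 1) \<le> 5 ^ t" by (intro power_increasing) auto
    also have "\<dots> \<le> int p ^ t" using ge_5 by (intro power_mono) auto
    also have "\<dots> \<le> int p ^ t * u" using \<open>u > 0\<close> by simp
    also have "\<dots> < 4 ^ k" using u(1) by (simp add: t_def)
    finally show False using * by simp
  qed
  then show ?thesis using that[of t u] u by (auto simp: t_def)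
qed

text \<open>The set S indexes a family w of integers prime to p that is, modulo p^a, mapped to itself by
doubling, the permutation s of S being the witness. Indexing, rather than a set of integers,
allows residues to occur repeatedly and lets w be the odd numbers 2j+1.\<close>

context
  fixes S :: "'a set" and w :: "'a \<Rightarrow> int" and s :: "'a \<Rightarrow> 'a" and a :: nat
  assumes fin: "finite S" and inj: "inj_on s S" and closed: "\<And>i. i \<in> S \<Longrightarrow> s i \<in> S"
    and unit: "\<And>i. i \<in> S \<Longrightarrow> \<not> int p dvd w i"
    and double: "\<And>i. i \<in> S \<Longrightarrow> int p ^ a dvd w (s i) - 2 * w i"
begin

lemma s_bij: "bij_betw s S S"
  using fin inj closed by (simp add: bij_betw_def endo_inj_surj image_subset_iff)

lemma inverse_square_double:
  assumes "i \<in> S"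
  shows "ldvd (of_nat p ^ a) (1 / of_int (w (s i)) ^ 2 - 1 / of_int (2 * w i) ^ 2)"
proof (rule ldvd_inverse_square_diff)
  show "\<not> int p dvd w (s i)" using assms closed unit by blast
  show "\<not> int p dvd 2 * w i"
    using assms unit prime_int not_dvd_small[of 2] by (auto simp: prime_dvd_mult_iff)
  show "ldvd (of_nat p ^ a) (of_int (w (s i) - 2 * w i))"
    using ldvd_of_int[OF double[OF assms]] by simp
qed

text \<open>Doubling the w(i) permutes the summands modulo p^a but divides the sum by 4, so three quarters of
the sum vanish modulo p^a.\<close>

lemma sum_inverse_square_doubling:
  "ldvd (of_nat p ^ a) (\<Sum>i\<in>S. 1 / of_int (w i) ^ 2)"
proof -
  let ?T = "\<Sum>i\<in>S. 1 / of_int (w i) ^ 2 :: rat"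
  have "?T = (\<Sum>i\<in>S. 1 / of_int (w (s i)) ^ 2)"
    using sum.reindex_bij_betw[OF s_bij, of "\<lambda>i. 1 / of_int (w i) ^ 2 :: rat"] by simp
  moreover have "(\<Sum>i\<in>S. 1 / of_int (2 * w i) ^ 2) = 1 / 4 * ?T"
    by (simp add: sum_distrib_left power_mult_distrib)
  ultimately have "?T - 1 / 4 * ?T
      = (\<Sum>i\<in>S. 1 / of_int (w (s i)) ^ 2 - 1 / of_int (2 * w i) ^ 2)"
    by (simp only: sum_subtractf)
  then have "ldvd (of_nat p ^ a) (4 * (?T - 1 / 4 * ?T))"
    using inverse_square_double by (auto intro!: ldvd_sum ldvd_mult_left)
  then have "ldvd (of_nat p ^ a) (of_int 3 * ?T)" by simp
  then show ?thesis by (rule ldvd_unit_cancel) (simp add: not_dvd_small)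
qed

text \<open>The product, as a polynomial in x, is invariant under x \<mapsto> x/4 modulo p^a. So its coefficient
of x^k becomes divisible by p^a after multiplication with 4^k - 1, and the p-part of
4^k - 1 can be paid for with x^(k-1).\<close>

lemma prod_one_minus_inverse_square_doubling:
  assumes x: "ldvd (of_nat p ^ 2) x"
  shows "ldvd (of_nat p ^ a * x) ((\<Prod>i\<in>S. 1 - x / of_int (w i) ^ 2) - 1)"
proof -
  define F :: "rat poly" where "F = (\<Prod>i\<in>S. [:1, - 1 / of_int (w i) ^ 2:])"
  have Fs: "F = (\<Prod>i\<in>S. [:1, - 1 / of_int (w (s i)) ^ 2:])"
    unfolding F_def
    using prod.reindex_bij_betw[OF s_bij, of "\<lambda>i. [:1, - 1 / of_int (w i) ^ 2:] :: rat poly"] by simp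
  have F4: "F \<circ>\<^sub>p [:0, 1 / 4:] = (\<Prod>i\<in>S. [:1, - 1 / of_int (2 * w i) ^ 2:])"
    unfolding F_def pcompose_prod by (simp add: pcompose_pCons power_mult_distrib mult.commute)
  have Z: "coeff [:1, - 1 / of_int v ^ 2:] k \<in> Z_loc p" if "\<not> int p dvd v" for v k
  proof -
    have "- ((1 / of_int v) ^ 2) \<in> Z_loc p" using Z_inverse[OF that] by blast
    then show ?thesis by (auto simp: coeff_pCons power_divide split: nat.split)
  qed
  have cF: "coeff F k \<in> Z_loc p \<and> ldvd (of_nat p ^ a) (coeff (F - F \<circ>\<^sub>p [:0, 1 / 4:]) k)" for k
    unfolding F4 unfolding Fs
  proof (rule ldvd_coeff_prod)
    fix i k assume i: "i \<in> S"
    show "coeff [:1, - 1 / of_int (w (s i)) ^ 2:] k \<in> Z_loc p"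
      using i closed unit by (intro Z) blast
    show "coeff [:1, - 1 / of_int (2 * w i) ^ 2:] k \<in> Z_loc p"
      using i unit prime_int not_dvd_small[of 2] by (intro Z) (auto simp: prime_dvd_mult_iff)
    have "ldvd (of_nat p ^ a) (- 1 * (1 / of_int (w (s i)) ^ 2 - 1 / of_int (2 * w i) ^ 2))"
      using inverse_square_double[OF i] by (intro ldvd_mult_left) auto
    then show "ldvd (of_nat p ^ a)
        (coeff ([:1, - 1 / of_int (w (s i)) ^ 2:] - [:1, - 1 / of_int (2 * w i) ^ 2:]) k)"
      by (auto simp: coeff_pCons split: nat.split)
  qed
  have monomial: "ldvd (of_nat p ^ a * x) (coeff F k * x ^ k)" if k: "k \<ge> 1" for k
  proof -
    obtain t u where tu: "(4::int) ^ k - 1 = int p ^ t * u" "\<not> int p dvd u" "t \<le> 2 * (k - 1)"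
      using four_power_minus_one_unit[OF k] .
    have "ldvd (of_nat p ^ a) (4 ^ k * coeff (F - F \<circ>\<^sub>p [:0, 1 / 4:]) k)"
      using cF by (intro ldvd_mult_left) auto
    also have "4 ^ k * coeff (F - F \<circ>\<^sub>p [:0, 1 / 4:]) k = of_int (4 ^ k - 1) * coeff F k"
      by (simp add: coeff_pcompose_linear algebra_simps power_divide)
    also have "\<dots> = of_int u * (of_nat p ^ t * coeff F k)"
      unfolding tu(1) by simp
    finally have 1: "ldvd (of_nat p ^ a) (of_nat p ^ t * coeff F k)"
      by (rule ldvd_unit_cancel) fact
    obtain y where y: "y \<in> Z_loc p" "x = of_nat p ^ 2 * y" using x by (auto simp: ldvd_def)
    \<comment> \<open>one factor x is kept for the modulus; the other k - 1 contain the p^t that clears 4^k - 1\<close>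
    have "x ^ (k - 1) = of_nat p ^ t * (of_nat p ^ (2 * (k - 1) - t) * y ^ (k - 1))"
      using tu(3) by (simp add: y power_mult_distrib mult.assoc[symmetric] flip: power_add power_mult)
    then have "coeff F k * x ^ k
        = (of_nat p ^ t * coeff F k) * x * (of_nat p ^ (2 * (k - 1) - t) * y ^ (k - 1))"
      using k by (cases k) (simp_all add: mult_ac)
    moreover have "ldvd (of_nat p ^ a * x) \<dots>"
      using y(1) ldvd_self[of 1 x] by (intro ldvd_mult_right[OF ldvd_mult[OF 1]] Z_mult Z_power) auto
    ultimately show ?thesis by (simp only:)
  qed
  have "(\<Prod>i\<in>S. 1 - x / of_int (w i) ^ 2) = poly F x"
    by (simp add: F_def poly_prod)
  also have "\<dots> = (\<Sum>k\<le>degree F. coeff F k * x ^ k)" by (rule poly_altdef)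
  also have "\<dots> = coeff F 0 + (\<Sum>k\<in>{1..degree F}. coeff F k * x ^ k)"
    by (simp add: atMost_atLeast0 sum.atLeast_Suc_atMost)
  also have "coeff F 0 = 1"
    by (simp add: F_def poly_0_coeff_0[symmetric] poly_prod)
  finally show ?thesis using monomial by (auto intro!: ldvd_sum)
qed

end

section \<open>Products over integers prime to p\<close>

definition unit_prod :: "rat \<Rightarrow> nat \<Rightarrow> rat" where
  "unit_prod x j = (\<Prod>i | i \<in> {1..j} \<and> \<not> p dvd i. 1 - x / of_nat i ^ 2)"

lemma Z_inverse_square: "\<not> p dvd i \<Longrightarrow> 1 / of_nat i ^ 2 \<in> Z_loc p"
  using Z_power[OF Z_inverse_nat, of i 2] by (simp add: power_divide)

lemma unit_factor_integral:
  assumes "\<not> p dvd i" "x \<in> Z_loc p"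
  shows "1 - x / of_nat i ^ 2 \<in> Z_loc p"
  using Z_diff[OF Z_1 Z_mult[OF assms(2) Z_inverse_square[OF assms(1)]]] by simp

lemma unit_prod_integral: "x \<in> Z_loc p \<Longrightarrow> unit_prod x j \<in> Z_loc p"
  unfolding unit_prod_def by (intro Z_prod unit_factor_integral) auto

lemma unit_prod_minus_1:
  assumes "x \<in> Z_loc p"
  shows "ldvd x (unit_prod x j - 1)"
proof -
  have "ldvd x (unit_prod x j - (\<Prod>i | i \<in> {1..j} \<and> \<not> p dvd i. 1))"
    unfolding unit_prod_def
  proof (rule ldvd_prod_diff)
    fix i assume "i \<in> {i. i \<in> {1..j} \<and> \<not> p dvd i}"
    then have i: "\<not> p dvd i" by simp
    show "1 - x / of_nat i ^ 2 \<in> Z_loc p" using i assms by (rule unit_factor_integral)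
    show "ldvd x (1 - x / of_nat i ^ 2 - 1)"
      using ldvd_self[OF Z_minus[OF Z_inverse_square[OF i]], of x] by simp
  qed simp
  then show ?thesis by simp
qed

text \<open>Doubling modulo q (followed by a shift by c) performed inside the block of q consecutive numbers
to which i belongs. Working blockwise keeps the index sets genuine intervals, which need not
have length q.\<close>

definition block_double :: "nat \<Rightarrow> nat \<Rightarrow> nat \<Rightarrow> nat" where
  "block_double q c i = q * (i div q) + (2 * i + c) mod q"

lemma block_double_div: "q > 0 \<Longrightarrow> block_double q c i div q = i div q"
  and block_double_mod: "block_double q c i mod q = (2 * i + c) mod q"
  by (simp_all add: block_double_def)

lemma inj_block_double:
  assumes "odd q"
  shows "inj (block_double q c)"
proof (rule injI)
  fix i j assume eq: "block_double q c i = block_double q c j"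
  have q: "q > 0" using assms by (cases q) auto
  have "(2 * i + c) mod q = (2 * j + c) mod q"
    using eq block_double_mod by metis
  then have "(2 * int i + int c) mod int q = (2 * int j + int c) mod int q"
    by (metis (no_types, opaque_lifting) of_nat_add of_nat_mult of_nat_numeral zmod_int)
  then have "int q dvd 2 * (int i - int j)"
    by (simp add: mod_eq_dvd_iff algebra_simps)
  moreover have "coprime (int q) 2" using assms by simp
  ultimately have "int q dvd int i - int j"
    using coprime_dvd_mult_right_iff by blast
  then have "i mod q = j mod q"
    by (metis mod_eq_dvd_iff of_nat_eq_iff zmod_int)
  moreover have "i div q = j div q" using eq block_double_div[OF q] by metis
  ultimately show "i = j" by (metis div_mult_mod_eq)
qed

lemma block_double_dvd:
  "int q dvd int (block_double q c i) - (2 * int i + int c)"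
proof -
  have "int (block_double q c i) mod int q = (2 * int i + int c) mod int q"
    using block_double_mod[of q c i]
    by (metis (no_types, opaque_lifting) of_nat_add of_nat_mult of_nat_numeral zmod_int)
  then show ?thesis by (simp add: mod_eq_dvd_iff)
qed

text \<open>The interval of length pM consists of blocks of length p^a, where p^a is the exact power of p in
pM. Blockwise doubling permutes its elements prime to p, which gives the modulus p^a x, and the
cofactor of p^a in pM is a unit.\<close>

lemma unit_prod_full:
  assumes x: "ldvd (of_nat p ^ 2) x" and "M > 0"
  shows "ldvd (of_nat p * of_nat M * x) (unit_prod x (p * M - 1) - 1)"
proof -
  obtain v M' where M': "M = p ^ v * M'" "\<not> p dvd M'"
    using multiplicity_decompose'[of M p] \<open>M > 0\<close> not_prime_unit prime by (metis less_irrefl)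
  define a where "a = Suc v"
  define q where "q = p ^ a"
  have q: "q > 0" "odd q" "p dvd q" using odd_p by (auto simp: q_def a_def)
  have pM: "p * M = M' * q" using M'(1) by (simp add: q_def a_def)
  let ?S = "{i. i \<in> {1..p * M - 1} \<and> \<not> p dvd i}"
  have S: "i \<in> ?S \<longleftrightarrow> i div q < M' \<and> \<not> p dvd i" for i
    using q(1) \<open>M > 0\<close> by (cases "i = 0") (auto simp: pM div_less_iff_less_mult)
  have "ldvd (of_nat p ^ a * x) ((\<Prod>i\<in>?S. 1 - x / of_int (int i) ^ 2) - 1)"
  proof (rule prod_one_minus_inverse_square_doubling[OF _ _ _ _ _ x])
    show "inj_on (block_double q 0) ?S"
      using inj_block_double[OF q(2)] by (rule inj_on_subset) simp
    fix i assume i: "i \<in> ?S"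
    have "\<not> p dvd 2 * i"
      using i prime ge_5 by (auto simp: prime_dvd_mult_iff dest: dvd_imp_le)
    then have "\<not> p dvd block_double q 0 i"
      using q(3) block_double_mod[of q 0 i] by (metis add_0_right dvd_mod_iff)
    then show "block_double q 0 i \<in> ?S"
      using i unfolding S by (simp add: block_double_div[OF q(1)])
    show "\<not> int p dvd int i" using i by simp
    show "int p ^ a dvd int (block_double q 0 i) - 2 * int i"
      using block_double_dvd[of q 0 i] by (simp add: q_def)
  qed simp
  then have "ldvd (of_nat p ^ a * x * of_int (int M')) (unit_prod x (p * M - 1) - 1)"
    using M'(2) by (intro ldvd_unit_mult) (simp_all add: unit_prod_def)
  moreover have "of_nat p ^ a * x * of_int (int M') = of_nat (p * M) * x"
    unfolding pM by (simp add: q_def)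
  ultimately show ?thesis by (simp only: of_nat_mult)
qed

text \<open>Reflecting i to 2j+1-i, where 2j+1 = p(2m+1), maps the lower half of the numbers 1, ..., 2j to
the upper half and changes 1/i^2 only modulo 2j+1. The square of the product over the lower half
is therefore congruent to the product over the full range.\<close>

lemma unit_prod_half:
  fixes m :: nat
  defines "j \<equiv> p * m + (p - 1) div 2"
  assumes x: "ldvd (of_nat p ^ 2) x"
  shows "ldvd (of_nat p * of_nat (2 * m + 1) * x) (unit_prod x j ^ 2 - 1)"
proof -
  let ?K = "p * (2 * m + 1)"
  have K: "?K = 2 * j + 1" using odd_p by (auto simp: j_def algebra_simps elim!: oddE)
  have xZ: "x \<in> Z_loc p" by (rule ldvd_integral[OF _ x]) auto
  let ?U = "{i. i \<in> {1..j} \<and> \<not> p dvd i}"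
  let ?V = "{i. i \<in> {j + 1..2 * j} \<and> \<not> p dvd i}"
  let ?P = "\<Prod>i\<in>?U. 1 - x / of_nat (?K - i) ^ 2"
  have dvd: "p dvd ?K - i \<longleftrightarrow> p dvd i" if "i \<le> ?K" for i
    using that by (metis dvd_diffD1 dvd_diff_nat dvd_triv_left)
  have "(\<Prod>i\<in>?V. 1 - x / of_nat i ^ 2) = ?P"
  proof (rule prod.reindex_bij_witness[of _ "\<lambda>i. ?K - i" "\<lambda>i. ?K - i"])
    fix i assume i: "i \<in> ?V"
    then show "?K - (?K - i) = i" using K by auto
    show "?K - i \<in> ?U" using i K dvd[of i] by auto
    show "1 - x / of_nat (?K - (?K - i)) ^ 2 = 1 - x / of_nat i ^ 2"
      using i K by auto
  next
    fix i assume i: "i \<in> ?U"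
    then show "?K - (?K - i) = i" using K by auto
    show "?K - i \<in> ?V" using i K dvd[of i] by auto
  qed
  moreover have "{i. i \<in> {1..?K - 1} \<and> \<not> p dvd i} = ?U \<union> ?V" unfolding K by auto
  moreover have "?U \<inter> ?V = {}" by auto
  ultimately have full: "unit_prod x (?K - 1) = unit_prod x j * ?P"
    unfolding unit_prod_def by (simp add: prod.union_disjoint)
  have "ldvd (of_nat ?K * x) (unit_prod x j - ?P)"
    unfolding unit_prod_def
  proof (rule ldvd_prod_diff)
    fix i assume i: "i \<in> ?U"
    then have iK: "i \<le> ?K" using K by auto
    have u: "\<not> p dvd i" "\<not> p dvd ?K - i" using i dvd[OF iK] by auto
    show "1 - x / of_nat i ^ 2 \<in> Z_loc p" "1 - x / of_nat (?K - i) ^ 2 \<in> Z_loc p"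
      using u xZ by (auto intro!: unit_factor_integral simp del: mult_Suc_right)
    have "ldvd (of_int (int ?K)) (1 / of_int (int i - int ?K) ^ 2 - 1 / of_int (int i) ^ 2)"
    proof (rule ldvd_inverse_square_diff)
      show "\<not> int p dvd int i" using u(1) by simp
      then show "\<not> int p dvd int i - int ?K" by (subst dvd_diff_left_iff) simp_all
      have "int i - int ?K - int i = - int ?K" by simp
      then show "ldvd (of_int (int ?K)) (of_int (int i - int ?K - int i))"
        using ldvd_of_int[of "int ?K" "- int ?K"] by (simp only: dvd_minus_iff dvd_refl)
    qed
    also have "of_int (int i - int ?K) ^ 2 = (of_nat (?K - i) :: rat) ^ 2"
      using iK by (simp only: of_nat_diff of_int_diff of_int_of_nat_eq power2_commute)
    finally have "ldvd (of_nat ?K * x) ((1 / of_nat (?K - i) ^ 2 - 1 / of_nat i ^ 2) * x)"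
      using ldvd_self[of 1 x] by (intro ldvd_mult) (simp_all only: of_int_of_nat_eq mult_1_right Z_1)
    then show "ldvd (of_nat ?K * x) (1 - x / of_nat i ^ 2 - (1 - x / of_nat (?K - i) ^ 2))"
      by (simp add: algebra_simps)
  qed
  then have "ldvd (of_nat ?K * x) ((unit_prod x j * ?P - 1) + unit_prod x j * (unit_prod x j - ?P))"
    using unit_prod_full[OF x, of "2 * m + 1"] xZ unfolding full
    by (intro ldvd_add ldvd_mult_left unit_prod_integral) (simp_all add: algebra_simps)
  moreover have "(unit_prod x j * ?P - 1) + unit_prod x j * (unit_prod x j - ?P) = unit_prod x j ^ 2 - 1"
    by (simp add: power2_eq_square algebra_simps)
  ultimately show ?thesis by (simp only: of_nat_mult)
qed

section \<open>Blocks of odd reciprocals\<close>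

text \<open>The reciprocals of the odd numbers prime to p, extended by 0 so that they can be summed over
full blocks.\<close>

definition odd_reciprocal :: "nat \<Rightarrow> rat" where
  "odd_reciprocal j = (if p dvd 2 * j + 1 then 0 else 1 / of_nat (2 * j + 1))"

lemma odd_reciprocal_integral: "odd_reciprocal j \<in> Z_loc p"
  unfolding odd_reciprocal_def
  by (cases "p dvd 2 * j + 1") (simp_all only: if_True if_False Z_0 Z_inverse_nat not_False_eq_True)

text \<open>In terms of the index j, doubling 2j+1 modulo q is the map j \<mapsto> 2j + (q+1)/2, since
2(2j + (q+1)/2) + 1 = 2(2j+1) + q.\<close>

lemma sum_inverse_square_odd_block:
  fixes m a :: nat
  defines "q \<equiv> p ^ a"
  assumes a: "a > 0"
  shows "ldvd (of_nat q) (\<Sum>j | j \<in> {m * q..<m * q + q} \<and> \<not> p dvd 2 * j + 1.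
           1 / of_nat (2 * j + 1) ^ 2)"
proof -
  have q: "q > 0" "odd q" "p dvd q" using odd_p a by (auto simp: q_def)
  define c where "c = (q + 1) div 2"
  have c: "2 * c = q + 1" using q(2) by (simp add: c_def)
  let ?S = "{j. j \<in> {m * q..<m * q + q} \<and> \<not> p dvd 2 * j + 1}"
  have S: "j \<in> ?S \<longleftrightarrow> j div q = m \<and> \<not> p dvd 2 * j + 1" for j
    using div_nat_eqI[where n = q and q = m and m = j] dividend_less_div_times[OF q(1), of j] div_times_less_eq_dividend[of j q]
    by (auto simp: mult.commute add.commute)
  have "ldvd (of_nat p ^ a) (\<Sum>j\<in>?S. 1 / of_int (int (2 * j + 1)) ^ 2)"
  proof (rule sum_inverse_square_doubling)
    show "inj_on (block_double q c) ?S"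
      using inj_block_double[OF q(2)] by (rule inj_on_subset) simp
    fix j assume j: "j \<in> ?S"
    show ju: "\<not> int p dvd int (2 * j + 1)" using j by (simp only: of_nat_dvd_iff) simp
    have "int q dvd 2 * (int (block_double q c j) - (2 * int j + int c)) + int q"
      by (intro dvd_add dvd_mult block_double_dvd dvd_refl)
    also have "\<dots> = int (2 * block_double q c j + 1) - 2 * int (2 * j + 1)"
      using c by simp
    finally show d: "int p ^ a dvd int (2 * block_double q c j + 1) - 2 * int (2 * j + 1)"
      by (simp add: q_def)
    have "int p dvd int (2 * block_double q c j + 1) - 2 * int (2 * j + 1)"
      using d a by (meson dvd_power dvd_trans)
    moreover have "\<not> int p dvd 2 * int (2 * j + 1)"
      using ju prime_int not_dvd_small[of 2] by (simp only: prime_dvd_mult_iff) simp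
    ultimately have "\<not> int p dvd int (2 * block_double q c j + 1)"
      using dvd_diff_right_iff by blast
    then show "block_double q c j \<in> ?S"
      using j unfolding S by (simp only: of_nat_dvd_iff block_double_div[OF q(1)]) simp
  qed simp
  then show ?thesis by (simp only: of_int_of_nat_eq q_def of_nat_power)
qed

text \<open>With u = 2j+1, the reflection of the block maps u to L - u, where L = 2q(2m+1). So twice the sum is
the sum of 1/u + 1/(L-u) = L/(u(L-u)). This gives one factor q; modulo L the remaining sum
is the negative of the sum of the 1/u^2, which contributes the second factor q.\<close>

lemma odd_reciprocal_block_sum:
  fixes m a :: nat
  defines "q \<equiv> p ^ a"
  shows "ldvd (of_nat p ^ (2 * a)) (\<Sum>j\<in>{m * q..<m * q + q}. odd_reciprocal j)"
proof (cases "a = 0")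
  case True
  then show ?thesis using odd_reciprocal_integral[of m] by (simp add: q_def)
next
  case False
  have q: "q > 0" "p dvd q" using False by (auto simp: q_def)
  let ?B = "{j. j \<in> {m * q..<m * q + q} \<and> \<not> p dvd 2 * j + 1}"
  define r where "r j = (2 * m + 1) * q - 1 - j" for j
  define L where "L = 2 * q * (2 * m + 1)"
  let ?T = "\<Sum>j\<in>?B. 1 / of_nat (2 * j + 1) :: rat"
  let ?Q = "\<Sum>j\<in>?B. 1 / of_nat (2 * j + 1) ^ 2 :: rat"
  have r: "2 * r j + 1 = L - (2 * j + 1)" "2 * j + 1 \<le> L" "r j \<in> {m * q..<m * q + q}" "r (r j) = j"
    if "j \<in> {m * q..<m * q + q}" for j
    using that by (auto simp: r_def L_def algebra_simps)
  have pL: "p dvd L" using q by (simp add: L_def)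
  have ru: "p dvd 2 * r j + 1 \<longleftrightarrow> p dvd 2 * j + 1" if "j \<in> {m * q..<m * q + q}" for j
    unfolding r(1)[OF that] using r(2)[OF that] pL by (metis dvd_diffD1 dvd_diff_nat)
  have "?T = (\<Sum>j\<in>?B. 1 / of_nat (2 * r j + 1))"
    by (rule sum.reindex_bij_witness[of _ r r]) (use r ru in auto)
  then have "2 * ?T = (\<Sum>j\<in>?B. 1 / of_nat (2 * j + 1) + 1 / of_nat (2 * r j + 1))"
    by (simp add: sum.distrib)
  also have "\<dots> = (\<Sum>j\<in>?B. of_nat L * (of_nat L *
      (1 / of_nat (2 * j + 1) * (1 / of_nat (2 * j + 1)) * (1 / of_nat (2 * r j + 1)))
      - 1 / of_nat (2 * j + 1) ^ 2))"
  proof (rule sum.cong)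
    fix j assume "j \<in> ?B"
    then have j: "j \<in> {m * q..<m * q + q}" by simp
    define u v where "u = (of_nat (2 * j + 1) :: rat)" and "v = (of_nat (2 * r j + 1) :: rat)"
    have nz: "u \<noteq> 0" "v \<noteq> 0" unfolding u_def v_def by (simp_all only: of_nat_eq_0_iff)
    have "of_nat L = u + v"
      unfolding u_def v_def r(1)[OF j] using r(2)[OF j] by (simp only: of_nat_diff)
    then show "1 / of_nat (2 * j + 1) + 1 / of_nat (2 * r j + 1) = (of_nat L * (of_nat L *
      (1 / of_nat (2 * j + 1) * (1 / of_nat (2 * j + 1)) * (1 / of_nat (2 * r j + 1)))
      - 1 / of_nat (2 * j + 1) ^ 2) :: rat)"
      unfolding u_def[symmetric] v_def[symmetric]
      using nz by (simp add: field_simps power2_eq_square)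
  qed simp
  also have "\<dots> = of_nat L * (of_nat L * (\<Sum>j\<in>?B.
      1 / of_nat (2 * j + 1) * (1 / of_nat (2 * j + 1)) * (1 / of_nat (2 * r j + 1))) - ?Q)"
    (is "_ = _ * (_ * ?R - _)")
    by (simp only: sum_subtractf flip: sum_distrib_left)
  finally have T: "2 * ?T = of_nat L * (of_nat L * ?R - ?Q)" .
  have qL: "ldvd (of_nat q) (of_nat L)"
    using ldvd_of_int[of "int q" "int L"] by (simp add: L_def)
  have "?R \<in> Z_loc p"
    unfolding ldvd_1[symmetric]
    by (intro ldvd_sum, unfold ldvd_1, intro Z_mult Z_inverse_nat) (use ru in auto)
  then have "ldvd (of_nat q) (of_nat L * ?R - ?Q)"
    using qL sum_inverse_square_odd_block[of a m] False unfolding q_def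
    by (intro ldvd_diff ldvd_mult_right) auto
  then have "ldvd (of_nat q * of_nat q) (2 * ?T)"
    unfolding T using qL by (intro ldvd_mult)
  then have "ldvd (of_nat q * of_nat q) ?T"
    using ldvd_unit_cancel[of _ 2 ?T] not_dvd_small[of 2] by simp
  moreover have "(\<Sum>j\<in>{m * q..<m * q + q}. odd_reciprocal j) = ?T"
    by (rule sum.mono_neutral_cong_right) (auto simp: odd_reciprocal_def)
  ultimately show ?thesis by (simp only: q_def power_add mult_2 of_nat_power)
qed


section \<open>Weighted sums from n to pn\<close>

lemma apery_weight_integral: "n > 0 \<Longrightarrow> apery_weight n j \<in> Z_loc p"
  using apery_weight_of_nat[of n j] by (metis Z_of_nat)

text \<open>Factors with p dividing i form the weight at level n, because (pn)^2/(pi)^2 = n^2/i^2.\<close>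

lemma apery_weight_mult_p:
  "apery_weight (p * n) j = apery_weight n (j div p) * unit_prod (of_nat (p * n) ^ 2) j ^ 2"
proof -
  let ?f = "\<lambda>i. 1 - of_nat (p * n) ^ 2 / of_nat i ^ 2 :: rat"
  have "i \<in> (\<lambda>i. p * i) ` {1..j div p}" if "i \<in> {1..j}" "p dvd i" for i
  proof (rule image_eqI)
    show "i = p * (i div p)" using that by simp
    show "i div p \<in> {1..j div p}" using that by (auto intro: div_le_mono elim!: dvdE)
  qed
  then have "{1..j} = (\<lambda>i. p * i) ` {1..j div p} \<union> {i. i \<in> {1..j} \<and> \<not> p dvd i}"
    by (auto simp: less_eq_div_iff_mult_less_eq mult.commute Suc_le_eq)
  moreover have "(\<lambda>i. p * i) ` {1..j div p} \<inter> {i. i \<in> {1..j} \<and> \<not> p dvd i} = {}" by auto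
  ultimately have "prod ?f {1..j} = prod ?f ((\<lambda>i. p * i) ` {1..j div p}) * unit_prod (of_nat (p * n) ^ 2) j"
    unfolding unit_prod_def by (metis (no_types, lifting) finite_Un finite_atLeastAtMost prod.union_disjoint)
  also have "prod ?f ((\<lambda>i. p * i) ` {1..j div p}) = (\<Prod>i=1..j div p. 1 - of_nat n ^ 2 / of_nat i ^ 2)"
    by (subst prod.reindex) (auto simp: inj_on_def power_mult_distrib intro!: prod.cong)
  finally show ?thesis by (simp add: apery_weight_def power_mult_distrib)
qed

lemma sum_blocks:
  fixes f :: "nat \<Rightarrow> rat"
  shows "(\<Sum>m\<in>{A..<A + k}. sum f {m * q..<m * q + q}) = sum f {A * q..<(A + k) * q}"
proof (induction k)
  case (Suc k)
  have "sum f {A * q..<(A + k) * q} + sum f {(A + k) * q..<(A + k) * q + q}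
      = sum f {A * q..<(A + k) * q + q}"
    by (rule sum.atLeastLessThan_concat) (simp_all add: mult_le_mono1)
  then show ?case using Suc by (simp add: algebra_simps)
qed simp

lemma unit_prod_square_minus_1:
  assumes "ldvd m (unit_prod x j - 1)" "x \<in> Z_loc p"
  shows "ldvd m (unit_prod x j ^ 2 - 1)"
proof -
  have "ldvd m ((unit_prod x j - 1) * (unit_prod x j + 1))"
    using assms by (intro ldvd_mult_right Z_add unit_prod_integral) auto
  then show ?thesis by (simp add: power2_eq_square algebra_simps)
qed

text \<open>If the sums of g over blocks of length p^b are divisible by p^(2b), then so are the sums
weighted with c: replacing c(pN,j) by c(N, j div p) costs an error divisible by (pN)^2, and the new
weight is constant on blocks of length p, so that g may be replaced by its block sums. The extra
exponent 2e records the divisibility that the block sums have gained in earlier steps.\<close>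

lemma weighted_sum_of_small_blocks:
  assumes "\<And>b m. ldvd (of_nat p ^ (2 * (b + e))) (\<Sum>j\<in>{m * p ^ b..<m * p ^ b + p ^ b}. g j)"
    and "n > 0"
  shows "ldvd (of_nat p ^ (2 * (a + e))) (\<Sum>j<p ^ a * n. apery_weight (p ^ a * n) j * g j)"
  using assms(1)
proof (induction a arbitrary: g e)
  case 0
  then have "ldvd (of_nat p ^ (2 * e)) (g j)" for j
    using 0[of 0 j] by simp
  then show ?case
    using \<open>n > 0\<close> by (auto intro!: ldvd_sum ldvd_mult_left apery_weight_integral)
next
  case (Suc a)
  define N where "N = p ^ a * n"
  have N: "N > 0" using \<open>n > 0\<close> by (simp add: N_def)
  define h where "h m = (\<Sum>j\<in>{m * p..<m * p + p}. g j)" for m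
  let ?W = "\<lambda>j. unit_prod (of_nat (p * N) ^ 2) j"
  have "ldvd (of_nat p ^ (2 * (b + Suc e))) (\<Sum>j\<in>{m * p ^ b..<m * p ^ b + p ^ b}. h j)" for b m
    using Suc.prems[of "Suc b" m] sum_blocks[of g p "m * p ^ b" "p ^ b"]
    by (simp add: h_def algebra_simps)
  then have "ldvd (of_nat p ^ (2 * (a + Suc e))) (\<Sum>m<N. apery_weight N m * h m)"
    unfolding N_def by (rule Suc.IH)
  moreover have "(\<Sum>m<N. apery_weight N m * h m) = (\<Sum>j<N * p. apery_weight N (j div p) * g j)"
  proof -
    have "(\<Sum>j\<in>{m * p..<m * p + p}. apery_weight N (j div p) * g j) = apery_weight N m * h m" for m
      unfolding h_def sum_distrib_left
    proof (rule sum.cong)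
      fix j assume "j \<in> {m * p..<m * p + p}"
      then have "j div p = m" by (intro div_nat_eqI) (auto simp: mult.commute)
      then show "apery_weight N (j div p) * g j = apery_weight N m * g j" by simp
    qed simp
    then show ?thesis by (simp flip: sum.nat_group)
  qed
  moreover have "ldvd (of_nat p ^ (2 * (a + Suc e)))
      (\<Sum>j<N * p. apery_weight N (j div p) * ((?W j ^ 2 - 1) * g j))"
  proof (rule ldvd_sum, rule ldvd_mult_left)
    fix j
    have "ldvd (of_nat (p * N) ^ 2) (?W j ^ 2 - 1)"
      by (rule unit_prod_square_minus_1) (auto intro!: unit_prod_minus_1 Z_power simp del: of_nat_mult)
    moreover have "ldvd (of_nat p ^ (2 * e)) (g j)"
      using Suc.prems[of 0 j] by simp
    ultimately have "ldvd (of_nat (p * N) ^ 2 * of_nat p ^ (2 * e)) ((?W j ^ 2 - 1) * g j)"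
      by (rule ldvd_mult)
    moreover have "of_nat (p * N) ^ 2 * of_nat p ^ (2 * e)
        = (of_nat p ^ (2 * (a + Suc e)) * of_nat n ^ 2 :: rat)"
      by (simp add: N_def power_mult_distrib power2_eq_square mult_2 mult_2_right power_add mult_ac)
    ultimately have "ldvd (of_nat p ^ (2 * (a + Suc e)) * of_nat n ^ 2) ((?W j ^ 2 - 1) * g j)"
      by (simp only:)
    then show "ldvd (of_nat p ^ (2 * (a + Suc e))) ((?W j ^ 2 - 1) * g j)"
      by (rule ldvd_trans[OF ldvd_self, rotated]) (rule Z_power, rule Z_of_nat)
    show "apery_weight N (j div p) \<in> Z_loc p" using N by (rule apery_weight_integral)
  qed
  ultimately have "ldvd (of_nat p ^ (2 * (a + Suc e)))
      ((\<Sum>j<N * p. apery_weight N (j div p) * g j)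
        + (\<Sum>j<N * p. apery_weight N (j div p) * ((?W j ^ 2 - 1) * g j)))"
    by (intro ldvd_add) (simp_all only:)
  also have "(\<Sum>j<N * p. apery_weight N (j div p) * g j)
        + (\<Sum>j<N * p. apery_weight N (j div p) * ((?W j ^ 2 - 1) * g j))
      = (\<Sum>j<p * N. apery_weight (p * N) j * g j)"
    unfolding apery_weight_mult_p sum.distrib[symmetric]
    by (intro sum.cong) (auto simp: algebra_simps)
  finally show ?case by (simp add: N_def mult.assoc)
qed

text \<open>The indices with p dividing 2j+1 are the j = pm + (p-1)/2, with 2j+1 = p(2m+1). Multiplied by p,
their terms match those at level n up to W(j)^2 - 1, whose divisibility by 2m+1 compensates the
denominator. The other indices are covered by the block sums, with p^(v+1) dividing pn, where v is
the order of p in n.\<close>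

lemma odd_weighted_sum_step:
  assumes "n > 0"
  shows "ldvd (of_nat p ^ (3 + 2 * multiplicity p n))
      (of_nat p * (\<Sum>j<p * n. apery_weight (p * n) j / of_nat (2 * j + 1))
       - (\<Sum>m<n. apery_weight n m / of_nat (2 * m + 1)))"
proof -
  obtain n' where n': "n = p ^ multiplicity p n * n'" "\<not> p dvd n'"
    using multiplicity_decompose'[of n p] assms not_prime_unit prime by (metis less_irrefl)
  define v where "v = multiplicity p n"
  have nv: "p * n = p ^ Suc v * n'" using n'(1) by (simp add: v_def)
  have "n' > 0" using n'(2) by (cases n') auto
  let ?x = "of_nat (p * n) ^ 2 :: rat"
  let ?J = "\<lambda>m. p * m + (p - 1) div 2"
  have J: "2 * ?J m + 1 = p * (2 * m + 1)" for m
    using odd_p by (auto simp: algebra_simps elim!: oddE)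
  have J_div: "?J m div p = m" for m
    by (rule div_nat_eqI) (use ge_5 in auto)
  have unit: "ldvd (of_nat p ^ (2 * (Suc v + 0))) (\<Sum>j<p ^ Suc v * n'. apery_weight (p ^ Suc v * n') j * odd_reciprocal j)"
    using odd_reciprocal_block_sum by (intro weighted_sum_of_small_blocks \<open>n' > 0\<close>) simp
  then have "ldvd (of_nat p * of_nat p ^ (2 * (Suc v + 0)))
      (of_nat p * (\<Sum>j<p * n. apery_weight (p * n) j * odd_reciprocal j))"
    unfolding nv by (intro ldvd_mult) (auto simp: ldvd_def intro: bexI[of _ 1])
  then have 1: "ldvd (of_nat p ^ (3 + 2 * v)) (of_nat p * (\<Sum>j<p * n. apery_weight (p * n) j * odd_reciprocal j))"
    by (simp add: numeral_3_eq_3)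
  have 2: "ldvd (of_nat p ^ (3 + 2 * v))
      (\<Sum>m<n. apery_weight n m * ((unit_prod ?x (?J m) ^ 2 - 1) / of_nat (2 * m + 1)))"
  proof (intro ldvd_sum ldvd_mult_left)
    fix m
    have "ldvd (of_nat p ^ 2) ?x" by (simp add: power_mult_distrib ldvd_self Z_power)
    then obtain z where z: "z \<in> Z_loc p"
      "unit_prod ?x (?J m) ^ 2 - 1 = of_nat p * of_nat (2 * m + 1) * ?x * z"
      using unit_prod_half[of ?x m] unfolding ldvd_def by blast
    have "(of_nat (2 * m + 1) :: rat) \<noteq> 0" by (simp only: of_nat_eq_0_iff)
    then have "(unit_prod ?x (?J m) ^ 2 - 1) / of_nat (2 * m + 1) = of_nat p * ?x * z"
      unfolding z(2) by simp
    also have "\<dots> = of_nat p ^ (3 + 2 * v) * (of_nat n' ^ 2 * z)"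
      unfolding nv by (simp add: power_mult_distrib power2_eq_square power3_eq_cube power_add power_mult mult_ac)
    finally show "ldvd (of_nat p ^ (3 + 2 * v)) ((unit_prod ?x (?J m) ^ 2 - 1) / of_nat (2 * m + 1))"
      using z(1) by (auto intro!: ldvd_self Z_mult Z_power)
  qed (use assms in \<open>rule apery_weight_integral\<close>)
  have "(\<Sum>j<p * n. apery_weight (p * n) j / of_nat (2 * j + 1))
      = (\<Sum>j<p * n. apery_weight (p * n) j * odd_reciprocal j
          + (if p dvd 2 * j + 1 then apery_weight (p * n) j / of_nat (2 * j + 1) else 0))"
    by (intro sum.cong) (auto simp: odd_reciprocal_def)
  also have "\<dots> = (\<Sum>j<p * n. apery_weight (p * n) j * odd_reciprocal j)
      + (\<Sum>j | j \<in> {..<p * n} \<and> p dvd 2 * j + 1. apery_weight (p * n) j / of_nat (2 * j + 1))"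
    unfolding sum.distrib by (simp add: sum.If_cases Int_def)
  also have "(\<Sum>j | j \<in> {..<p * n} \<and> p dvd 2 * j + 1. apery_weight (p * n) j / of_nat (2 * j + 1))
      = (\<Sum>m<n. apery_weight (p * n) (?J m) / of_nat (2 * ?J m + 1))"
  proof (rule sum.reindex_bij_witness[of _ ?J "\<lambda>j. j div p"])
    fix m assume m: "m \<in> {..<n}"
    have "?J m < p * Suc m" using ge_5 by auto
    also have "\<dots> \<le> p * n" using m by (intro mult_le_mono2) auto
    finally show "?J m \<in> {j. j \<in> {..<p * n} \<and> p dvd 2 * j + 1}" unfolding mem_Collect_eq J by simp
    show "?J m div p = m" by (rule J_div)
  next
    fix j assume "j \<in> {j. j \<in> {..<p * n} \<and> p dvd 2 * j + 1}"
    then have j: "j < p * n" "p dvd 2 * j + 1" by auto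
    then obtain k where k: "2 * j + 1 = p * k" by (elim dvdE)
    then have "odd k" by (metis even_mult_iff odd_two_times_div_two_succ even_plus_one_iff dvd_triv_left)
    then obtain m where "k = 2 * m + 1" by (elim oddE)
    then have jm: "j = ?J m" using k J[of m] by simp
    show "j div p \<in> {..<n}" using less_mult_imp_div_less[of j n p] j(1) by (simp add: mult.commute)
    show "?J (j div p) = j" using jm J_div[of m] by (simp only:)
    then show "apery_weight (p * n) (?J (j div p)) / of_nat (2 * ?J (j div p) + 1)
        = apery_weight (p * n) j / of_nat (2 * j + 1)" by simp
  qed
  finally have "of_nat p * (\<Sum>j<p * n. apery_weight (p * n) j / of_nat (2 * j + 1))
       - (\<Sum>m<n. apery_weight n m / of_nat (2 * m + 1))
      = of_nat p * (\<Sum>j<p * n. apery_weight (p * n) j * odd_reciprocal j)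
       + (\<Sum>m<n. of_nat p * (apery_weight (p * n) (?J m) / of_nat (2 * ?J m + 1))
            - apery_weight n m / of_nat (2 * m + 1))"
    by (simp only: distrib_left sum_subtractf sum_distrib_left add_diff_eq)
  also have "(\<Sum>m<n. of_nat p * (apery_weight (p * n) (?J m) / of_nat (2 * ?J m + 1))
            - apery_weight n m / of_nat (2 * m + 1))
      = (\<Sum>m<n. apery_weight n m * ((unit_prod ?x (?J m) ^ 2 - 1) / of_nat (2 * m + 1)))"
    unfolding J apery_weight_mult_p J_div of_nat_mult[of p "2 * _ + 1"]
    by (intro sum.cong) (simp_all add: diff_divide_distrib right_diff_distrib)
  finally show ?thesis using ldvd_add[OF 1 2] by (simp add: v_def)
qed

text \<open>This integrality rests on n (n-1 choose m) = (m+1) (n choose m+1).\<close>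

lemma apery_weight_over_square:
  assumes "n > 0"
  shows "of_nat n ^ 2 * apery_weight n m / of_nat (Suc m) ^ 2 \<in> Z_loc p"
proof -
  have "Suc m * (n choose Suc m) = n * ((n - 1) choose m)"
    by (rule binomial_absorption)
  then have "of_nat n * of_nat ((n - 1) choose m) = (of_nat (Suc m) * of_nat (n choose Suc m) :: rat)"
    by (metis of_nat_mult)
  then have "of_nat n ^ 2 * apery_weight n m
      = of_nat (Suc m) ^ 2 * (of_nat (n choose Suc m) * of_nat ((n + m) choose m) :: rat) ^ 2"
    unfolding apery_weight_binomial[OF assms] power_mult_distrib[symmetric]
    by (metis mult.assoc mult.commute)
  then have "of_nat n ^ 2 * apery_weight n m / of_nat (Suc m) ^ 2
      = (of_nat (n choose Suc m) * of_nat ((n + m) choose m) :: rat) ^ 2"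
    by (simp del: of_nat_Suc)
  then show ?thesis by (auto intro!: Z_power Z_mult)
qed

text \<open>Only indices with j+1 = p(m+1) are critical. There W(j)^2 - 1 is divisible by p^3 n^2 (m+1), which
leaves the denominator (m+1)^2 to be cancelled by n^2 c(n,m).\<close>

lemma cube_weighted_sum_step:
  assumes "n > 0"
  shows "ldvd (of_nat p ^ 3)
      (of_nat p ^ 3 * (\<Sum>j<p * n. apery_weight (p * n) j / of_nat (Suc j) ^ 3)
       - (\<Sum>m<n. apery_weight n m / of_nat (Suc m) ^ 3))"
proof -
  let ?x = "of_nat (p * n) ^ 2 :: rat"
  let ?J = "\<lambda>m. p * Suc m - 1"
  let ?t = "\<lambda>j. apery_weight (p * n) j / of_nat (Suc j) ^ 3"
  have J: "Suc (?J m) = p * Suc m" for m using p_gt_0 by (simp del: p_gt_0)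
  have J_div: "?J m div p = m" for m
    by (rule div_nat_eqI) (use ge_5 in auto)
  have 1: "ldvd (of_nat p ^ 3 * 1) (of_nat p ^ 3 * (\<Sum>j | j \<in> {..<p * n} \<and> \<not> p dvd Suc j. ?t j))"
  proof (rule ldvd_mult)
    show "ldvd 1 (\<Sum>j | j \<in> {..<p * n} \<and> \<not> p dvd Suc j. ?t j)"
    proof (rule ldvd_sum)
      fix j assume "j \<in> {j. j \<in> {..<p * n} \<and> \<not> p dvd Suc j}"
      then have "apery_weight (p * n) j * (1 / of_nat (Suc j)) ^ 3 \<in> Z_loc p"
        using assms by (intro Z_mult Z_power Z_inverse_nat apery_weight_integral) auto
      then show "ldvd 1 (?t j)" by (simp add: power_divide)
    qed
  qed (auto simp: ldvd_def intro: bexI[of _ 1])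
  have 2: "ldvd (of_nat p ^ 3)
      (\<Sum>m<n. apery_weight n m * ((unit_prod ?x (?J m) ^ 2 - 1) / of_nat (Suc m) ^ 3))"
  proof (rule ldvd_sum)
    fix m
    have "ldvd (of_nat p ^ 2) ?x" by (simp add: power_mult_distrib ldvd_self Z_power)
    then have "ldvd (of_nat p * of_nat (Suc m) * ?x) (unit_prod ?x (?J m) ^ 2 - 1)"
      by (intro unit_prod_square_minus_1 unit_prod_full) (auto intro!: Z_power simp del: of_nat_mult)
    then obtain z where z: "z \<in> Z_loc p"
      "unit_prod ?x (?J m) ^ 2 - 1 = of_nat p * of_nat (Suc m) * ?x * z"
      unfolding ldvd_def by blast
    have "(of_nat (Suc m) :: rat) \<noteq> 0" by (simp only: of_nat_eq_0_iff)
    then have "apery_weight n m * ((unit_prod ?x (?J m) ^ 2 - 1) / of_nat (Suc m) ^ 3)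
        = of_nat p ^ 3 * (of_nat n ^ 2 * apery_weight n m / of_nat (Suc m) ^ 2 * z)"
      unfolding z(2) by (simp add: power2_eq_square power3_eq_cube del: of_nat_Suc)
    then show "ldvd (of_nat p ^ 3) (apery_weight n m * ((unit_prod ?x (?J m) ^ 2 - 1) / of_nat (Suc m) ^ 3))"
      using apery_weight_over_square[OF assms] z(1) by (simp only: ldvd_self Z_mult)
  qed
  have "(\<Sum>j<p * n. ?t j) = (\<Sum>j<p * n. if p dvd Suc j then ?t j else ?t j)" by simp
  also have "\<dots> = (\<Sum>j | j \<in> {..<p * n} \<and> p dvd Suc j. ?t j) + (\<Sum>j | j \<in> {..<p * n} \<and> \<not> p dvd Suc j. ?t j)"
    by (subst sum.If_cases) (auto simp: Int_def simp del: if_cancel)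
  also have "(\<Sum>j | j \<in> {..<p * n} \<and> p dvd Suc j. ?t j) = (\<Sum>m<n. ?t (?J m))"
  proof (rule sum.reindex_bij_witness[of _ ?J "\<lambda>j. j div p"])
    fix m assume m: "m \<in> {..<n}"
    have "?J m < p * Suc m" using J[of m] by simp
    also have "\<dots> \<le> p * n" using m by (intro mult_le_mono2) auto
    finally show "?J m \<in> {j. j \<in> {..<p * n} \<and> p dvd Suc j}" unfolding mem_Collect_eq J by simp
    show "?J m div p = m" by (rule J_div)
  next
    fix j assume "j \<in> {j. j \<in> {..<p * n} \<and> p dvd Suc j}"
    then have j: "j < p * n" "p dvd Suc j" by auto
    then obtain k where k: "Suc j = p * k" by (elim dvdE)
    then obtain m where "k = Suc m" by (cases k) auto
    then have jm: "j = ?J m" using k by simp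
    show "j div p \<in> {..<n}" using less_mult_imp_div_less[of j n p] j(1) by (simp add: mult.commute)
    show "?J (j div p) = j" using jm J_div[of m] by simp
    then show "?t (?J (j div p)) = ?t j" by simp
  qed
  finally have "of_nat p ^ 3 * (\<Sum>j<p * n. ?t j) - (\<Sum>m<n. apery_weight n m / of_nat (Suc m) ^ 3)
      = of_nat p ^ 3 * (\<Sum>j | j \<in> {..<p * n} \<and> \<not> p dvd Suc j. ?t j)
        + (\<Sum>m<n. of_nat p ^ 3 * ?t (?J m) - apery_weight n m / of_nat (Suc m) ^ 3)"
    by (simp only: distrib_left sum_subtractf sum_distrib_left add_diff_eq add.commute)
  also have "(\<Sum>m<n. of_nat p ^ 3 * ?t (?J m) - apery_weight n m / of_nat (Suc m) ^ 3)
      = (\<Sum>m<n. apery_weight n m * ((unit_prod ?x (?J m) ^ 2 - 1) / of_nat (Suc m) ^ 3))"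
    unfolding J apery_weight_mult_p J_div of_nat_mult[of p "Suc _"]
    by (intro sum.cong) (simp_all add: power_mult_distrib diff_divide_distrib right_diff_distrib del: of_nat_Suc)
  finally show ?thesis using ldvd_add[OF 1[unfolded mult_1_right] 2] by simp
qed

end

theorem theorem1:
  fixes p n :: nat
  assumes "prime p" and "p \<ge> 5" and "n > 0"
  shows "rat_cong_0
           (1 / of_nat n *
             ((\<Sum>k=0..p * n - 1. (2 * of_nat k + 1) * of_nat (apery k))
              - of_nat p * (\<Sum>k=0..n - 1. (2 * of_nat k + 1) * of_nat (apery k))))
           p (4 + 3 * multiplicity p n)
       \<and> rat_cong_0
           (1 / of_nat n ^ 3 *
             ((\<Sum>k=0..p * n - 1. (2 * of_nat k + 1) ^ 3 * of_nat (apery k))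
              - of_nat p ^ 3 * (\<Sum>k=0..n - 1. (2 * of_nat k + 1) ^ 3 * of_nat (apery k))))
           p (6 + 3 * multiplicity p n)"
proof -
  interpret prime_ge_5 p using assms by unfold_locales
  obtain n' where "n = p ^ multiplicity p n * n'"
    using multiplicity_dvd[of p n] by (elim dvdE)
  then have n': "(of_nat n :: rat) = of_nat p ^ multiplicity p n * of_nat n'"
    by (metis of_nat_mult of_nat_power)
  have n: "(of_nat n :: rat) \<noteq> 0" using \<open>n > 0\<close> by simp
  have interval: "{0..k - 1} = {..<k}" if "k > 0" for k :: nat
    using that by (auto simp: less_eq_Suc_le)
  have pn: "p * n > 0" using \<open>n > 0\<close> by simp
  let ?E = "\<lambda>n. \<Sum>j<n. apery_weight n j / of_nat (2 * j + 1)"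
  let ?V = "\<lambda>n. \<Sum>j<n. apery_weight n j / of_nat (Suc j) ^ 3"
  have "1 / of_nat n * (of_nat (p * n) ^ 2 * ?E (p * n) - of_nat p * (of_nat n ^ 2 * ?E n))
      = of_nat p * of_nat n * (of_nat p * ?E (p * n) - ?E n)"
    using n by (simp add: power2_eq_square field_simps)
  also have "\<dots> = (of_nat n' * (of_nat p ^ (1 + multiplicity p n) * (of_nat p * ?E (p * n) - ?E n)))"
    unfolding n' by simp
  finally have E: "1 / of_nat n * (of_nat (p * n) ^ 2 * ?E (p * n) - of_nat p * (of_nat n ^ 2 * ?E n)) = \<dots>" .
  have "ldvd (of_nat p ^ (1 + multiplicity p n) * of_nat p ^ (3 + 2 * multiplicity p n))
      (of_nat n' * (of_nat p ^ (1 + multiplicity p n) * (of_nat p * ?E (p * n) - ?E n)))"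
    using odd_weighted_sum_step[OF \<open>n > 0\<close>] ldvd_self[of 1 "of_nat p ^ (1 + multiplicity p n)"]
    by (intro ldvd_mult_left ldvd_mult) auto
  moreover have "1 + multiplicity p n + (3 + 2 * multiplicity p n) = 4 + 3 * multiplicity p n" by simp
  ultimately have 1: "ldvd (of_nat p ^ (4 + 3 * multiplicity p n))
     (1 / of_nat n * (of_nat (p * n) ^ 2 * ?E (p * n) - of_nat p * (of_nat n ^ 2 * ?E n)))"
    unfolding E by (simp only: power_add[symmetric])
  have "1 / of_nat n ^ 3 * (of_nat (p * n) ^ 6 * ?V (p * n) - of_nat p ^ 3 * (of_nat n ^ 6 * ?V n))
      = of_nat p ^ 3 * of_nat n ^ 3 * (of_nat p ^ 3 * ?V (p * n) - ?V n)"
    using n by (simp add: field_simps flip: power_add)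
  also have "\<dots> = of_nat n' ^ 3 * (of_nat p ^ (3 + 3 * multiplicity p n) * (of_nat p ^ 3 * ?V (p * n) - ?V n))"
    unfolding n' by (simp add: power_mult_distrib power_add mult_ac flip: power_mult)
  finally have V: "1 / of_nat n ^ 3 * (of_nat (p * n) ^ 6 * ?V (p * n) - of_nat p ^ 3 * (of_nat n ^ 6 * ?V n)) = \<dots>" .
  have "ldvd (of_nat p ^ (3 + 3 * multiplicity p n) * of_nat p ^ 3)
      (of_nat n' ^ 3 * (of_nat p ^ (3 + 3 * multiplicity p n) * (of_nat p ^ 3 * ?V (p * n) - ?V n)))"
    using cube_weighted_sum_step[OF \<open>n > 0\<close>] ldvd_self[of 1 "of_nat p ^ (3 + 3 * multiplicity p n)"]
    by (intro ldvd_mult_left ldvd_mult Z_power) auto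
  moreover have "3 + 3 * multiplicity p n + 3 = 6 + 3 * multiplicity p n" by simp
  ultimately have 2: "ldvd (of_nat p ^ (6 + 3 * multiplicity p n))
     (1 / of_nat n ^ 3 * (of_nat (p * n) ^ 6 * ?V (p * n) - of_nat p ^ 3 * (of_nat n ^ 6 * ?V n)))"
    unfolding V by (simp only: power_add[symmetric])
  show ?thesis
    unfolding rat_cong_0_iff interval[OF \<open>n > 0\<close>] interval[OF pn] sum_odd_apery
      sum_odd_cube_apery[OF \<open>n > 0\<close>] sum_odd_cube_apery[OF pn]
    using 1 2 by blast
qed

end
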